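(* Let $R$ be a ring. If $R$ is nil-semicommutative, then $R$ is NJ-reflexive. Consequently, if $R$ is semicommutative, then $R$ is NJ-reflexive.
   Context: All rings are associative with unity. $N(R)$ denotes the set of nilpotent elements of $R$ and $J(R)$ the Jacobson radical of $R$. A ring $R$ is NJ-reflexive if for all $x,y\in R$, $xRy\subseteq N(R)$ implies $yRx\subseteq J(R)$. A ring $R$ is semicommutative if for all $x,y\in R$, $xy=0$ implies $xRy=0$. A ring $R$ is nil-semicommutative if for all $x,y\in R$, $xy\in N(R)$ implies $xRy\subseteq N(R)$. *)

theory Defs
  imports "HOL-Algebra.Ring" "HOL-Algebra.AbelCoset"
begin

text \<open>
  Rings are the associative, unital, not necessarily commutative rings of the locale
  \<^locale>\<open>ring\<close>; the zero ring is included.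
\<close>

definition nilpotents :: "('a, 'b) ring_scheme \<Rightarrow> 'a set" where
  "nilpotents R = {a \<in> carrier R. \<exists>n::nat. n > 0 \<and> a [^]\<^bsub>R\<^esub> n = \<zero>\<^bsub>R\<^esub>}"

text \<open>HOL-Algebra's ideals are two-sided, so left ideals are introduced here.\<close>

definition left_ideal :: "'a set \<Rightarrow> ('a, 'b) ring_scheme \<Rightarrow> bool" where
  "left_ideal I R \<longleftrightarrow>
     additive_subgroup I R \<and> (\<forall>r \<in> carrier R. \<forall>a \<in> I. r \<otimes>\<^bsub>R\<^esub> a \<in> I)"

definition maximal_left_ideal :: "'a set \<Rightarrow> ('a, 'b) ring_scheme \<Rightarrow> bool" where
  "maximal_left_ideal M R \<longleftrightarrow>
     left_ideal M R \<and> M \<noteq> carrier R \<and>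
     (\<forall>I. left_ideal I R \<and> M \<subseteq> I \<longrightarrow> I = M \<or> I = carrier R)"

text \<open>
  The Jacobson radical is the intersection of all maximal left ideals, taken inside the
  carrier; for the zero ring, which has no maximal left ideal, it is the whole ring.
\<close>

definition jacobson_radical :: "('a, 'b) ring_scheme \<Rightarrow> 'a set" where
  "jacobson_radical R = {a \<in> carrier R. \<forall>M. maximal_left_ideal M R \<longrightarrow> a \<in> M}"

text \<open>The set $xRy$ of all products $xry$ with $r \in R$ (not of sums of such products).\<close>

definition sandwich :: "('a, 'b) ring_scheme \<Rightarrow> 'a \<Rightarrow> 'a \<Rightarrow> 'a set" where
  "sandwich R x y = {x \<otimes>\<^bsub>R\<^esub> r \<otimes>\<^bsub>R\<^esub> y | r. r \<in> carrier R}"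

definition NJ_reflexive :: "('a, 'b) ring_scheme \<Rightarrow> bool" where
  "NJ_reflexive R \<longleftrightarrow>
     (\<forall>x \<in> carrier R. \<forall>y \<in> carrier R.
        sandwich R x y \<subseteq> nilpotents R \<longrightarrow> sandwich R y x \<subseteq> jacobson_radical R)"

definition semicommutative :: "('a, 'b) ring_scheme \<Rightarrow> bool" where
  "semicommutative R \<longleftrightarrow>
     (\<forall>x \<in> carrier R. \<forall>y \<in> carrier R.
        x \<otimes>\<^bsub>R\<^esub> y = \<zero>\<^bsub>R\<^esub> \<longrightarrow> sandwich R x y = {\<zero>\<^bsub>R\<^esub>})"

definition nil_semicommutative :: "('a, 'b) ring_scheme \<Rightarrow> bool" where
  "nil_semicommutative R \<longleftrightarrow>
     (\<forall>x \<in> carrier R. \<forall>y \<in> carrier R.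
        x \<otimes>\<^bsub>R\<^esub> y \<in> nilpotents R \<longrightarrow> sandwich R x y \<subseteq> nilpotents R)"

end

theory Submission
  imports Defs
begin

text \<open>
  In a nil-semicommutative ring the set \<open>N\<close> of nilpotent elements is closed under left
  multiplication: if \<open>a = \<one>a\<close> is nilpotent, then so is every \<open>\<one>sa = sa\<close>. An element \<open>a\<close> such
  that \<open>Ra \<subseteq> N\<close> lies in the Jacobson radical: a maximal left ideal \<open>M\<close> that omits \<open>a\<close> satisfies
  \<open>M + Ra = R\<close>, so it contains some \<open>\<one> - sa\<close>, which is a unit because \<open>sa\<close> is nilpotent, and
  \<open>M\<close> would not be proper. Hence \<open>N \<subseteq> J\<close>, and it remains to see that \<open>xRy \<subseteq> N\<close> gives
  \<open>yRx \<subseteq> N\<close>. Here \<open>xy \<in> N\<close>, so \<open>yx \<in> N\<close> by \<open>(yx)^(n+1) = y(xy)^n x\<close>, and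
  nil-semicommutativity applies to the product \<open>yx\<close>.

  Semicommutative rings are nil-semicommutative: in a vanishing word \<open>xyxy\<dots>xy\<close> a factor \<open>r\<close>
  can be inserted between each \<open>x\<close> and the following \<open>y\<close>, one place at a time, while the word
  remains zero.
\<close>

lemma nilpotentsI:
  assumes "ring R" "a \<in> carrier R" "a [^]\<^bsub>R\<^esub> (n::nat) = \<zero>\<^bsub>R\<^esub>"
  shows "a \<in> nilpotents R"
proof -
  interpret ring R by fact
  (* The definition asks for a positive exponent, hence Suc n. *)
  have "a [^]\<^bsub>R\<^esub> Suc n = \<zero>\<^bsub>R\<^esub>" using assms(2,3) by simp
  then show ?thesis using assms(2) unfolding nilpotents_def by blast
qed

lemma nilpotentsE:
  assumes "a \<in> nilpotents R"
  obtains n :: nat where "a [^]\<^bsub>R\<^esub> n = \<zero>\<^bsub>R\<^esub>"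
  using assms unfolding nilpotents_def by blast

lemma left_idealD:
  assumes "left_ideal I R"
  shows "additive_subgroup I R"
    and "r \<in> carrier R \<Longrightarrow> a \<in> I \<Longrightarrow> r \<otimes>\<^bsub>R\<^esub> a \<in> I"
  using assms unfolding left_ideal_def by auto

context ring
begin

lemma swap_mult_nat_pow:
  assumes x: "x \<in> carrier R" and y: "y \<in> carrier R"
  shows "(y \<otimes> x) [^] Suc n = y \<otimes> (x \<otimes> y) [^] n \<otimes> x"
proof (induction n)
  case 0
  show ?case using x y by simp
next
  case (Suc n)
  have "(y \<otimes> x) [^] Suc (Suc n) = (y \<otimes> x) [^] Suc n \<otimes> (y \<otimes> x)" by simp
  then show ?case unfolding Suc.IH using x y by (simp add: m_assoc)
qed

lemma nilpotents_swap:
  assumes x: "x \<in> carrier R" and y: "y \<in> carrier R" and nil: "x \<otimes> y \<in> nilpotents R"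
  shows "y \<otimes> x \<in> nilpotents R"
proof -
  obtain n :: nat where n: "(x \<otimes> y) [^] n = \<zero>" using nil by (rule nilpotentsE)
  have "(y \<otimes> x) [^] Suc n = \<zero>" using x y by (simp only: swap_mult_nat_pow n) simp
  then show ?thesis using x y nilpotentsI[OF ring_axioms] by blast
qed

lemma sandwich_one: "a \<in> carrier R \<Longrightarrow> s \<in> carrier R \<Longrightarrow> s \<otimes> a \<in> sandwich R \<one> a"
  unfolding sandwich_def by force

lemma nil_semicommutative_left_mult:
  assumes "nil_semicommutative R" "a \<in> nilpotents R" "s \<in> carrier R"
  shows "s \<otimes> a \<in> nilpotents R"
proof -
  have a: "a \<in> carrier R" using assms(2) by (simp add: nilpotents_def)
  then have "\<one> \<otimes> a \<in> nilpotents R" using assms(2) by simp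
  then have "sandwich R \<one> a \<subseteq> nilpotents R"
    using assms(1) a unfolding nil_semicommutative_def by blast
  then show ?thesis using sandwich_one[OF a assms(3)] by blast
qed

text \<open>
  If \<open>b\<close> is nilpotent, then \<open>\<one> - b\<close> is a unit, so no proper left ideal contains it. Here this is
  read off modulo \<open>I\<close>: since \<open>\<one> \<equiv> b\<close>, every power of \<open>b\<close> is congruent to \<open>\<one>\<close>, and some power
  is zero.
\<close>

lemma left_ideal_one_minus_nilpotent:
  assumes I: "left_ideal I R" and b: "b \<in> nilpotents R" and mem: "\<one> \<ominus> b \<in> I"
  shows "I = carrier R"
proof -
  interpret I: additive_subgroup I R using I by (rule left_idealD)
  have bc: "b \<in> carrier R" using b by (simp add: nilpotents_def)
  have pow: "\<one> \<ominus> b [^] n \<in> I" for n :: nat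
  proof (induction n)
    case 0
    show ?case by (simp add: minus_eq r_neg)
  next
    case (Suc n)
    have "b [^] n \<otimes> (\<one> \<ominus> b) \<in> I" using I mem bc by (simp add: left_idealD)
    then have "(\<one> \<ominus> b [^] n) \<oplus> b [^] n \<otimes> (\<one> \<ominus> b) \<in> I" using Suc.IH by simp
    moreover have "(\<one> \<ominus> b [^] n) \<oplus> b [^] n \<otimes> (\<one> \<ominus> b) = \<one> \<ominus> b [^] Suc n"
      using bc by (simp add: minus_eq r_distr r_minus a_assoc r_neg1)
    ultimately show ?case by simp
  qed
  obtain n :: nat where "b [^] n = \<zero>" using b by (rule nilpotentsE)
  then have one: "\<one> \<in> I" using pow[of n] by (simp add: minus_eq)
  show ?thesis
  proof
    show "I \<subseteq> carrier R" by (rule I.a_subset)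
    show "carrier R \<subseteq> I"
    proof
      fix r assume "r \<in> carrier R"
      then show "r \<in> I" using left_idealD(2)[OF I _ one, of r] by simp
    qed
  qed
qed

lemma left_ideal_add_principal:
  assumes M: "left_ideal M R" and a: "a \<in> carrier R"
  shows "left_ideal {m \<oplus> s \<otimes> a | m s. m \<in> M \<and> s \<in> carrier R} R" (is "left_ideal ?I R")
proof -
  interpret M: additive_subgroup M R using M by (rule left_idealD)
  note Mc = M.a_Hcarr
  have "subgroup ?I (add_monoid R)"
  proof (rule add.subgroupI)
    show "?I \<subseteq> carrier R" using a Mc by auto
    show "?I \<noteq> {}" using M.zero_closed by blast
  next
    fix u assume "u \<in> ?I"
    then obtain m s where u: "u = m \<oplus> s \<otimes> a" "m \<in> M" "s \<in> carrier R" by blast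
    then have "\<ominus> u = \<ominus> m \<oplus> (\<ominus> s) \<otimes> a" using a Mc by (simp add: minus_add l_minus)
    then show "\<ominus> u \<in> ?I" using u M.a_inv_closed by blast
  next
    fix u v assume "u \<in> ?I" "v \<in> ?I"
    then obtain m s m' s' where uv: "u = m \<oplus> s \<otimes> a" "v = m' \<oplus> s' \<otimes> a"
      and ms: "m \<in> M" "s \<in> carrier R" "m' \<in> M" "s' \<in> carrier R" by blast
    have "u \<oplus> v = (m \<oplus> m') \<oplus> (s \<oplus> s') \<otimes> a"
      using uv ms a Mc by (simp add: l_distr a_ac)
    then show "u \<oplus> v \<in> ?I" using ms M.a_closed by blast
  qed
  then have "additive_subgroup ?I R" by (rule additive_subgroupI)
  moreover have "r \<otimes> u \<in> ?I" if r: "r \<in> carrier R" and "u \<in> ?I" for r u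
  proof -
    obtain m s where u: "u = m \<oplus> s \<otimes> a" "m \<in> M" "s \<in> carrier R" using \<open>u \<in> ?I\<close> by blast
    then have "r \<otimes> u = r \<otimes> m \<oplus> (r \<otimes> s) \<otimes> a" using r a Mc by (simp add: r_distr m_assoc)
    then show ?thesis using u r left_idealD(2)[OF M] by blast
  qed
  ultimately show ?thesis unfolding left_ideal_def by blast
qed

lemma maximal_left_ideal_one_minus:
  assumes M: "maximal_left_ideal M R" and a: "a \<in> carrier R" and notin: "a \<notin> M"
  obtains s where "s \<in> carrier R" "\<one> \<ominus> s \<otimes> a \<in> M"
proof -
  have li: "left_ideal M R" using M by (simp add: maximal_left_ideal_def)
  interpret M: additive_subgroup M R using li by (rule left_idealD)
  let ?I = "{m \<oplus> s \<otimes> a | m s. m \<in> M \<and> s \<in> carrier R}"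
  have "M \<subseteq> ?I"
  proof
    fix m assume "m \<in> M"
    moreover from this have "m = m \<oplus> \<zero> \<otimes> a" using a M.a_Hcarr by simp
    ultimately show "m \<in> ?I" by blast
  qed
  moreover have "a \<in> ?I"
  proof -
    have "a = \<zero> \<oplus> \<one> \<otimes> a" using a by simp
    then show ?thesis using M.zero_closed by blast
  qed
  ultimately have "?I = carrier R"
    using M left_ideal_add_principal[OF li a] notin unfolding maximal_left_ideal_def by blast
  then obtain m s where ms: "\<one> = m \<oplus> s \<otimes> a" "m \<in> M" "s \<in> carrier R" using one_closed by blast
  then have "\<one> \<ominus> s \<otimes> a = m" using a M.a_Hcarr by (simp add: minus_eq a_assoc r_neg)
  then show thesis using ms that by simp
qed

lemma jacobson_radicalI:
  assumes a: "a \<in> carrier R" and nil: "\<And>s. s \<in> carrier R \<Longrightarrow> s \<otimes> a \<in> nilpotents R"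
  shows "a \<in> jacobson_radical R"
proof -
  have "a \<in> M" if M: "maximal_left_ideal M R" for M
  proof (rule ccontr)
    assume "a \<notin> M"
    then obtain s where "s \<in> carrier R" "\<one> \<ominus> s \<otimes> a \<in> M"
      using maximal_left_ideal_one_minus[OF M a] by blast
    then have "M = carrier R"
      using left_ideal_one_minus_nilpotent M nil unfolding maximal_left_ideal_def by blast
    then show False using M unfolding maximal_left_ideal_def by blast
  qed
  then show ?thesis using a unfolding jacobson_radical_def by blast
qed

lemma nil_semicommutative_imp_NJ_reflexive:
  assumes nsc: "nil_semicommutative R"
  shows "NJ_reflexive R"
  unfolding NJ_reflexive_def
proof (intro ballI impI)
  fix x y assume x: "x \<in> carrier R" and y: "y \<in> carrier R"
    and xRy: "sandwich R x y \<subseteq> nilpotents R"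
  have "x \<otimes> \<one> \<otimes> y \<in> sandwich R x y" unfolding sandwich_def by blast
  then have "x \<otimes> y \<in> nilpotents R" using xRy x by auto
  then have "y \<otimes> x \<in> nilpotents R" using x y by (rule nilpotents_swap[rotated 2])
  then have yRx: "sandwich R y x \<subseteq> nilpotents R"
    using nsc x y unfolding nil_semicommutative_def by blast
  show "sandwich R y x \<subseteq> jacobson_radical R"
  proof
    fix a assume "a \<in> sandwich R y x"
    then have a: "a \<in> nilpotents R" using yRx by blast
    then have "a \<in> carrier R" by (simp add: nilpotents_def)
    then show "a \<in> jacobson_radical R"
      using jacobson_radicalI nil_semicommutative_left_mult[OF nsc a] by blast
  qed
qed

text \<open>
  The induction replaces the factors \<open>xy\<close> of \<open>(xy)^n = \<zero>\<close> by \<open>xry\<close> from left to right: the first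
  \<open>k\<close> have been replaced, and \<open>m\<close> are left.
\<close>

lemma semicommutative_insert_factors:
  assumes sc: "semicommutative R"
    and x: "x \<in> carrier R" and y: "y \<in> carrier R" and r: "r \<in> carrier R"
    and zero: "(x \<otimes> y) [^] (k + m :: nat) = \<zero>"
  shows "(x \<otimes> r \<otimes> y) [^] k \<otimes> (x \<otimes> y) [^] m = \<zero>"
  using zero
proof (induction k arbitrary: m)
  case 0
  then show ?case using x y by simp
next
  case (Suc k)
  let ?p = "(x \<otimes> r \<otimes> y) [^] k \<otimes> x" and ?q = "y \<otimes> (x \<otimes> y) [^] m"
  have "(x \<otimes> r \<otimes> y) [^] k \<otimes> (x \<otimes> y) [^] Suc m = \<zero>" using Suc.IH[of "Suc m"] Suc.prems by simp
  moreover have "(x \<otimes> y) [^] Suc m = x \<otimes> y \<otimes> (x \<otimes> y) [^] m"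
    using x y by (simp only: nat_pow_Suc2 m_closed)
  ultimately have "?p \<otimes> ?q = \<zero>" using x y r by (simp add: m_assoc)
  then have "sandwich R ?p ?q = {\<zero>}"
    using sc x y r unfolding semicommutative_def by simp
  then have "?p \<otimes> r \<otimes> ?q = \<zero>" using r unfolding sandwich_def by blast
  then show ?case using x y r by (simp add: m_assoc)
qed

lemma semicommutative_imp_nil_semicommutative:
  assumes sc: "semicommutative R"
  shows "nil_semicommutative R"
  unfolding nil_semicommutative_def
proof (intro ballI impI subsetI)
  fix x y a assume x: "x \<in> carrier R" and y: "y \<in> carrier R"
    and nil: "x \<otimes> y \<in> nilpotents R" and "a \<in> sandwich R x y"
  then obtain r where r: "r \<in> carrier R" and a: "a = x \<otimes> r \<otimes> y" unfolding sandwich_def by blast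
  obtain n :: nat where "(x \<otimes> y) [^] n = \<zero>" using nil by (rule nilpotentsE)
  then have "a [^] n = \<zero>"
    using semicommutative_insert_factors[OF sc x y r, of n 0] x y r a by simp
  then show "a \<in> nilpotents R" using x y r a nilpotentsI[OF ring_axioms] by simp
qed

end

theorem corollary2p7:
  fixes R :: "('a, 'b) ring_scheme"
  assumes "ring R"
  shows "(nil_semicommutative R \<longrightarrow> NJ_reflexive R) \<and> (semicommutative R \<longrightarrow> NJ_reflexive R)"
  using ring.nil_semicommutative_imp_NJ_reflexive[OF assms]
    ring.semicommutative_imp_nil_semicommutative[OF assms]
  by blast

end
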